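(* There exists a multipartite GEUPB (in some finite-dimensional space $\mathcal H_1\otimes\dots\otimes\mathcal H_k$ with $k\geq3$) if and only if, for some integer $n$, there exists a GEUPB in $\mathbb C^n\otimes\mathbb C^n\otimes\mathbb C^n$.
   Context: A set of orthonormal product vectors in $\mathcal H_1\otimes\dots\otimes\mathcal H_k$ is an unextendible product basis (UPB) if it spans a proper subspace and no $k$-partite product vector is orthogonal to all its elements. A subspace of $\mathcal H_1\otimes\dots\otimes\mathcal H_k$ is genuinely entangled (GE) if it is nonzero and contains no nonzero vector that is a bipartite product vector with respect to some bipartition of the $k$ systems into two nonempty groups. A GEUPB is a UPB (of $k$-partite product vectors) whose orthogonal complement is a GE subspace. *)

theory Defs
  imports Complex_Main "HOL-Library.FuncSet" "HOL-Library.Function_Algebras"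
begin

text \<open>
  The parties form a finite set \<open>I\<close> of labels, and party \<open>i\<close> holds the Hilbert space of
  dimension \<open>d i\<close>, identified with coordinate space via an orthonormal basis labelled by
  \<open>{..<d i}\<close>. The tensor product of these spaces has the induced orthonormal basis
  labelled by the multi-indices below; a vector is its family of coordinates, extended by zero
  to all of \<open>nat \<Rightarrow> nat\<close> so that equality of coordinates is equality of functions.
  Zero-dimensional factors are not excluded: they make the whole space zero, and the zero
  space has no proper subspace, hence no unextendible product basis.
\<close>

type_synonym tensor = "(nat \<Rightarrow> nat) \<Rightarrow> complex"

definition tscale :: "complex \<Rightarrow> tensor \<Rightarrow> tensor" where
  "tscale c v = (\<lambda>x. c * v x)"

interpretation tensor: vector_space tscale
  by unfold_locales (auto simp: tscale_def fun_eq_iff algebra_simps)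

definition multi_indices :: "nat set \<Rightarrow> (nat \<Rightarrow> nat) \<Rightarrow> (nat \<Rightarrow> nat) set" where
  "multi_indices I d = (\<Pi>\<^sub>E i\<in>I. {..<d i})"

definition tensor_space :: "nat set \<Rightarrow> (nat \<Rightarrow> nat) \<Rightarrow> tensor set" where
  "tensor_space I d = {v. \<forall>x. x \<notin> multi_indices I d \<longrightarrow> v x = 0}"

definition tensor_inner :: "nat set \<Rightarrow> (nat \<Rightarrow> nat) \<Rightarrow> tensor \<Rightarrow> tensor \<Rightarrow> complex" where
  "tensor_inner I d u v = (\<Sum>x\<in>multi_indices I d. cnj (u x) * v x)"

text \<open>
  The tensor product of local vectors \<open>a i\<close>. Only the coordinates \<open>a i j\<close> with
  \<open>i \<in> I\<close> and \<open>j < d i\<close> enter.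
\<close>

definition tensor_prod :: "nat set \<Rightarrow> (nat \<Rightarrow> nat) \<Rightarrow> (nat \<Rightarrow> nat \<Rightarrow> complex) \<Rightarrow> tensor" where
  "tensor_prod I d a = (\<lambda>x. if x \<in> multi_indices I d then \<Prod>i\<in>I. a i (x i) else 0)"

definition product_vector :: "nat set \<Rightarrow> (nat \<Rightarrow> nat) \<Rightarrow> tensor \<Rightarrow> bool" where
  "product_vector I d v \<longleftrightarrow> v \<noteq> 0 \<and> (\<exists>a. v = tensor_prod I d a)"

text \<open>
  The tensor product of a vector of the parties in \<open>A\<close> with a vector of the parties in
  \<open>B\<close>, where \<open>A\<close> and \<open>B\<close> are disjoint.
\<close>

definition tensor_pair ::
    "nat set \<Rightarrow> nat set \<Rightarrow> (nat \<Rightarrow> nat) \<Rightarrow> tensor \<Rightarrow> tensor \<Rightarrow> tensor" where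
  "tensor_pair A B d f g =
     (\<lambda>x. if x \<in> multi_indices (A \<union> B) d then f (restrict x A) * g (restrict x B) else 0)"

definition biproduct_vector :: "nat set \<Rightarrow> nat set \<Rightarrow> (nat \<Rightarrow> nat) \<Rightarrow> tensor \<Rightarrow> bool" where
  "biproduct_vector A B d v \<longleftrightarrow>
     v \<noteq> 0 \<and> (\<exists>f\<in>tensor_space A d. \<exists>g\<in>tensor_space B d. v = tensor_pair A B d f g)"

definition orthonormal :: "nat set \<Rightarrow> (nat \<Rightarrow> nat) \<Rightarrow> tensor set \<Rightarrow> bool" where
  "orthonormal I d S \<longleftrightarrow>
     (\<forall>u\<in>S. \<forall>v\<in>S. tensor_inner I d u v = (if u = v then 1 else 0))"

definition orth_complement :: "nat set \<Rightarrow> (nat \<Rightarrow> nat) \<Rightarrow> tensor set \<Rightarrow> tensor set" where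
  "orth_complement I d S = {v \<in> tensor_space I d. \<forall>u\<in>S. tensor_inner I d u v = 0}"

definition upb :: "nat set \<Rightarrow> (nat \<Rightarrow> nat) \<Rightarrow> tensor set \<Rightarrow> bool" where
  "upb I d S \<longleftrightarrow>
     (\<forall>v\<in>S. product_vector I d v) \<and> orthonormal I d S \<and>
     tensor.span S \<subset> tensor_space I d \<and>
     \<not> (\<exists>v. product_vector I d v \<and> (\<forall>u\<in>S. tensor_inner I d u v = 0))"

definition genuinely_entangled :: "nat set \<Rightarrow> (nat \<Rightarrow> nat) \<Rightarrow> tensor set \<Rightarrow> bool" where
  "genuinely_entangled I d W \<longleftrightarrow>
     tensor.subspace W \<and> W \<subseteq> tensor_space I d \<and> W \<noteq> {0} \<and>
     (\<forall>A B. A \<noteq> {} \<and> B \<noteq> {} \<and> A \<inter> B = {} \<and> A \<union> B = I \<longrightarrow>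
        \<not> (\<exists>v\<in>W. biproduct_vector A B d v))"

definition geupb :: "nat set \<Rightarrow> (nat \<Rightarrow> nat) \<Rightarrow> tensor set \<Rightarrow> bool" where
  "geupb I d S \<longleftrightarrow> upb I d S \<and> genuinely_entangled I d (orth_complement I d S)"

end

theory Submission
  imports Defs
begin

text \<open>
  Merging parties keeps the vectors of a GEUPB product vectors, and keeps its complement
  genuinely entangled because every bipartition of the merged system is one of the original
  system; three groups therefore suffice. To make the three dimensions equal, embed each
  local space into \<open>\<complex>\<^sup>n\<close> by an injection of basis labels, and add to the basis all standard
  basis vectors outside the image of the embedding. These are product vectors, and the
  orthogonal complement of the enlarged family is the embedded old complement.
\<close>

section \<open>Tensor spaces and their inner product\<close>

lemma finite_multi_indices: "finite I \<Longrightarrow> finite (multi_indices I d)"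
  unfolding multi_indices_def by (intro finite_PiE) auto

lemma restrict_multi_indices:
  "x \<in> multi_indices I d \<Longrightarrow> A \<subseteq> I \<Longrightarrow> restrict x A \<in> multi_indices A d"
  by (auto simp: multi_indices_def PiE_def Pi_def)

lemma subspace_tensor_space: "tensor.subspace (tensor_space I d)"
  by (auto simp: tensor.subspace_def tensor_space_def tscale_def)

lemma subspace_orthogonal: "tensor.subspace {v. tensor_inner I d u v = 0}"
proof -
  have "tensor_inner I d u (tscale c v) = c * tensor_inner I d u v" for c v
    by (simp add: tensor_inner_def tscale_def sum_distrib_left mult.left_commute)
  then show ?thesis
    by (auto simp: tensor.subspace_def tensor_inner_def sum.distrib distrib_left)
qed

lemma tensor_inner_cnj: "tensor_inner I d v u = cnj (tensor_inner I d u v)"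
  by (simp add: tensor_inner_def mult.commute)

lemma subspace_orth_complement: "tensor.subspace (orth_complement I d S)"
proof -
  have "orth_complement I d S =
      tensor_space I d \<inter> \<Inter> ((\<lambda>u. {v. tensor_inner I d u v = 0}) ` S)"
    by (auto simp: orth_complement_def)
  then show ?thesis
    using subspace_orthogonal
    by (auto intro!: tensor.subspace_inter tensor.subspace_Inter subspace_tensor_space)
qed

lemma tensor_inner_self_eq_0:
  assumes "finite I" "v \<in> tensor_space I d" "tensor_inner I d v v = 0"
  shows "v = 0"
proof -
  let ?M = "multi_indices I d"
  have "complex_of_real (\<Sum>x\<in>?M. (cmod (v x))\<^sup>2) = 0"
    using assms(3)
    by (simp add: tensor_inner_def complex_norm_square mult.commute del: of_real_power)
  then have "(\<Sum>x\<in>?M. (cmod (v x))\<^sup>2) = 0"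
    using of_real_eq_0_iff by blast
  then have "\<forall>x\<in>?M. v x = 0"
    by (simp add: sum_nonneg_eq_0_iff finite_multi_indices assms(1))
  then show ?thesis
    using assms(2) by (auto simp: tensor_space_def fun_eq_iff)
qed

lemma tensor_prod_in_tensor_space: "tensor_prod I d a \<in> tensor_space I d"
  by (simp add: tensor_prod_def tensor_space_def)

text \<open>The product of the local factors over \<open>A \<union> B\<close> splits into the
  product over \<open>A\<close> times the product over \<open>B\<close>. Hence a genuinely entangled
  subspace contains no fully product vector, as soon as some bipartition exists.\<close>

lemma product_vector_imp_biproduct_vector:
  assumes "product_vector (A \<union> B) d v" "finite A" "finite B" "A \<inter> B = {}"
  shows "biproduct_vector A B d v"
proof -
  obtain a where v: "v = tensor_prod (A \<union> B) d a"
    using assms(1) by (auto simp: product_vector_def)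
  have "v = tensor_pair A B d (tensor_prod A d a) (tensor_prod B d a)"
  proof
    fix x
    show "v x = tensor_pair A B d (tensor_prod A d a) (tensor_prod B d a) x"
      using restrict_multi_indices[of x "A \<union> B" d A] restrict_multi_indices[of x "A \<union> B" d B]
      by (simp add: v tensor_pair_def tensor_prod_def prod.union_disjoint assms)
  qed
  then show ?thesis
    using assms(1) tensor_prod_in_tensor_space
    unfolding biproduct_vector_def product_vector_def by blast
qed

lemma genuinely_entangledD:
  assumes "genuinely_entangled I d W" "v \<in> W"
    and "A \<noteq> {}" "B \<noteq> {}" "A \<inter> B = {}" "A \<union> B = I"
  shows "\<not> biproduct_vector A B d v"
  using assms unfolding genuinely_entangled_def by blast

lemma genuinely_entangled_nonzero:
  assumes "genuinely_entangled I d W"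
  shows "\<exists>w\<in>W. w \<noteq> 0"
proof -
  have "0 \<in> W" and "W \<noteq> {0}"
    using assms tensor.subspace_0[of W] by (simp_all add: genuinely_entangled_def)
  then show ?thesis by blast
qed

text \<open>Genuine entanglement of the complement already yields the other two UPB conditions. A
  product vector orthogonal to \<open>S\<close> would be a biproduct vector in the complement, and a
  nonzero vector of the complement cannot lie in the span. The sets \<open>A\<close> and
  \<open>B\<close> provide one bipartition against which entanglement can be tested.\<close>

lemma geupb_iff:
  assumes "finite I" "A \<noteq> {}" "B \<noteq> {}" "A \<inter> B = {}" "A \<union> B = I"
  shows "geupb I d S \<longleftrightarrow> (\<forall>v\<in>S. product_vector I d v) \<and> orthonormal I d S \<and>
    genuinely_entangled I d (orth_complement I d S)" (is "_ \<longleftrightarrow> ?prod \<and> ?on \<and> ?ge")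
proof
  assume "geupb I d S"
  then show "?prod \<and> ?on \<and> ?ge" by (simp add: geupb_def upb_def)
next
  assume R: "?prod \<and> ?on \<and> ?ge"
  have SS: "S \<subseteq> tensor_space I d"
    using R tensor_prod_in_tensor_space by (auto simp: product_vector_def)
  have no_product: "\<not> (\<exists>v. product_vector I d v \<and> (\<forall>u\<in>S. tensor_inner I d u v = 0))"
  proof
    assume "\<exists>v. product_vector I d v \<and> (\<forall>u\<in>S. tensor_inner I d u v = 0)"
    then obtain v where v: "product_vector I d v" "\<forall>u\<in>S. tensor_inner I d u v = 0" by blast
    then have "v \<in> orth_complement I d S"
      using tensor_prod_in_tensor_space by (auto simp: orth_complement_def product_vector_def)
    moreover have "biproduct_vector A B d v"
      using product_vector_imp_biproduct_vector[of A B d v] v assms by auto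
    ultimately show False
      using R genuinely_entangledD assms(2-5) by blast
  qed
  obtain w where w: "w \<in> orth_complement I d S" "w \<noteq> 0"
    using R genuinely_entangled_nonzero by blast
  \<comment> \<open>The span lies in the hyperplane orthogonal to \<open>w\<close>, while
    \<open>w\<close> itself does not, because its inner product with itself is nonzero.\<close>
  have "tensor.span S \<subseteq> {v. tensor_inner I d w v = 0}"
    using w(1)
    by (intro tensor.span_minimal subspace_orthogonal)
       (auto simp: orth_complement_def tensor_inner_cnj[of I d w])
  then have "w \<notin> tensor.span S"
    using w assms(1) tensor_inner_self_eq_0[of I w d] by (auto simp: orth_complement_def)
  moreover have "w \<in> tensor_space I d"
    using w(1) by (simp add: orth_complement_def)
  ultimately have "tensor.span S \<subset> tensor_space I d"
    using tensor.span_minimal[OF SS subspace_tensor_space] by blast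
  with R no_product show "geupb I d S"
    by (simp add: geupb_def upb_def)
qed

section \<open>Standard basis vectors\<close>

definition basis_tensor :: "(nat \<Rightarrow> nat) \<Rightarrow> tensor" where
  "basis_tensor y = (\<lambda>x. if x = y then 1 else 0)"

lemma tensor_inner_basis_tensor:
  assumes "finite I" "y \<in> multi_indices I d"
  shows "tensor_inner I d (basis_tensor y) v = v y"
  using assms by (simp add: tensor_inner_def basis_tensor_def finite_multi_indices
      if_distrib[of cnj] if_distrib[of "\<lambda>c. c * _"] cong: if_cong)

lemma product_vector_basis_tensor:
  assumes "finite I" "y \<in> multi_indices I d"
  shows "product_vector I d (basis_tensor y)"
proof -
  have "basis_tensor y = tensor_prod I d (\<lambda>i m. if m = y i then 1 else 0)"
  proof
    fix x
    have "x = y" if "x \<in> multi_indices I d" "\<forall>i\<in>I. x i = y i"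
      using that assms(2) by (auto simp: multi_indices_def intro: PiE_ext)
    then show "basis_tensor y x = tensor_prod I d (\<lambda>i m. if m = y i then 1 else 0) x"
      using assms by (auto simp: basis_tensor_def tensor_prod_def)
  qed
  moreover have "basis_tensor y \<noteq> 0"
    by (auto simp: basis_tensor_def fun_eq_iff)
  ultimately show ?thesis
    by (auto simp: product_vector_def)
qed

section \<open>Merging parties and enlarging local dimensions\<close>

text \<open>The parties \<open>i\<close> with the same label \<open>\<pi> i\<close> are merged; \<open>e j\<close> embeds the basis of block \<open>j\<close>.\<close>

locale coarsening =
  fixes I :: "nat set" and d :: "nat \<Rightarrow> nat" and J :: "nat set" and d' :: "nat \<Rightarrow> nat"
    and \<pi> :: "nat \<Rightarrow> nat" and e :: "nat \<Rightarrow> (nat \<Rightarrow> nat) \<Rightarrow> nat"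
  assumes finite_I: "finite I"
    and J_eq: "J = \<pi> ` I"
    and inj_e: "j \<in> J \<Longrightarrow> inj_on (e j) (multi_indices {i\<in>I. \<pi> i = j} d)"
    and e_less: "j \<in> J \<Longrightarrow> z \<in> multi_indices {i\<in>I. \<pi> i = j} d \<Longrightarrow> e j z < d' j"
begin

section \<open>The isometry induced by an embedding of basis labels\<close>

definition block :: "nat \<Rightarrow> nat set" where
  "block j = {i\<in>I. \<pi> i = j}"

text \<open>A basis label of the merged party \<open>j\<close> stands for a whole multi-index of its
  block, coded by \<open>e j\<close> as a single number below \<open>d' j\<close>.\<close>

definition embed :: "(nat \<Rightarrow> nat) \<Rightarrow> (nat \<Rightarrow> nat)" where
  "embed x = (\<lambda>j\<in>J. e j (restrict x (block j)))"

text \<open>Since \<open>embed\<close> is injective on multi-indices, this maps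
  \<open>tensor_space I d\<close> isometrically onto the vectors supported on the image of
  \<open>embed\<close>. Its adjoint is \<open>pull\<close>, which also inverts it there.\<close>

definition push :: "tensor \<Rightarrow> tensor" where
  "push v = (\<lambda>y. if y \<in> embed ` multi_indices I d
     then v (the_inv_into (multi_indices I d) embed y) else 0)"

definition pull :: "tensor \<Rightarrow> tensor" where
  "pull v = (\<lambda>x. if x \<in> multi_indices I d then v (embed x) else 0)"

lemma finite_J: "finite J"
  by (simp add: J_eq finite_I)

lemma block_subset: "block j \<subseteq> I"
  by (auto simp: block_def)

lemma restrict_block:
  "x \<in> multi_indices I d \<Longrightarrow> restrict x (block j) \<in> multi_indices (block j) d"
  by (rule restrict_multi_indices[OF _ block_subset])

lemma inj_on_e: "j \<in> J \<Longrightarrow> inj_on (e j) (multi_indices (block j) d)"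
  using inj_e by (simp add: block_def)

lemma embed_in: "x \<in> multi_indices I d \<Longrightarrow> embed x \<in> multi_indices J d'"
  using restrict_block[of x] e_less
  by (auto simp: embed_def multi_indices_def[of J] block_def)

lemma inj_embed: "inj_on embed (multi_indices I d)"
proof (rule inj_onI)
  fix x x' assume x: "x \<in> multi_indices I d" "x' \<in> multi_indices I d" and eq: "embed x = embed x'"
  have "x i = x' i" if i: "i \<in> I" for i
  proof -
    have j: "\<pi> i \<in> J" using i by (simp add: J_eq)
    have "e (\<pi> i) (restrict x (block (\<pi> i))) = e (\<pi> i) (restrict x' (block (\<pi> i)))"
      using fun_cong[OF eq, of "\<pi> i"] j by (simp add: embed_def)
    then have "restrict x (block (\<pi> i)) = restrict x' (block (\<pi> i))"
      using inj_on_e[OF j] x restrict_block by (auto dest: inj_onD)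
    from fun_cong[OF this, of i] show ?thesis
      using i by (simp add: block_def)
  qed
  then show "x = x'"
    using x by (auto simp: multi_indices_def intro: PiE_ext)
qed

text \<open>The blocks partition \<open>I\<close>, so multi-indices chosen independently for the
  blocks glue to one multi-index of \<open>I\<close>. The image of \<open>embed\<close> is thus a
  full box, which is what lets extension by zero respect product structure.\<close>

lemma in_range_embed:
  assumes y: "y \<in> multi_indices J d'"
    and range: "\<And>j. j \<in> J \<Longrightarrow> y j \<in> e j ` multi_indices (block j) d"
  shows "y \<in> embed ` multi_indices I d"
proof -
  obtain z where z: "\<And>j. j \<in> J \<Longrightarrow> z j \<in> multi_indices (block j) d \<and> y j = e j (z j)"
    using range unfolding image_iff by metis
  \<comment> \<open>The entry of party \<open>i\<close> is read from the multi-index chosen for the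
    block containing \<open>i\<close>.\<close>
  define x where "x = (\<lambda>i\<in>I. z (\<pi> i) i)"
  have r: "restrict x (block j) = z j" if "j \<in> J" for j
    using z[OF that] block_subset[of j]
    by (auto simp: x_def block_def multi_indices_def fun_eq_iff PiE_def extensional_def)
  have "x \<in> multi_indices I d"
    using z by (auto simp: x_def multi_indices_def J_eq block_def PiE_iff)
  moreover have "y = embed x"
    using y z by (auto simp: embed_def r multi_indices_def PiE_def extensional_def)
  ultimately show ?thesis by blast
qed

lemma push_embed: "x \<in> multi_indices I d \<Longrightarrow> push v (embed x) = v x"
  by (simp add: push_def the_inv_into_f_f inj_embed)

lemma push_outside: "y \<notin> embed ` multi_indices I d \<Longrightarrow> push v y = 0"
  by (simp add: push_def)

lemma push_in: "push v \<in> tensor_space J d'"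
  using embed_in by (auto simp: tensor_space_def push_def)

lemma pull_in: "pull v \<in> tensor_space I d"
  by (simp add: tensor_space_def pull_def)

lemma pull_push: "v \<in> tensor_space I d \<Longrightarrow> pull (push v) = v"
  by (auto simp: pull_def push_embed tensor_space_def)

lemma push_pull:
  assumes "\<And>y. y \<notin> embed ` multi_indices I d \<Longrightarrow> v y = 0"
  shows "push (pull v) = v"
proof
  fix y show "push (pull v) y = v y"
    by (cases "y \<in> embed ` multi_indices I d")
       (auto simp: push_embed pull_def push_outside assms)
qed

lemma tensor_inner_push: "tensor_inner J d' (push u) v = tensor_inner I d u (pull v)"
proof -
  have "tensor_inner J d' (push u) v =
      (\<Sum>y\<in>embed ` multi_indices I d. cnj (push u y) * v y)"
    unfolding tensor_inner_def
    using embed_in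
    by (intro sum.mono_neutral_right finite_multi_indices finite_J) (auto simp: push_outside)
  also have "\<dots> = tensor_inner I d u (pull v)"
    by (simp add: sum.reindex[OF inj_embed] push_embed tensor_inner_def pull_def)
  finally show ?thesis .
qed

lemma push_0: "push 0 = 0" and pull_0: "pull 0 = 0"
  by (auto simp: push_def pull_def fun_eq_iff)

text \<open>The local factors are grouped by block: each merged party receives the tensor product of
  the factors in its block.\<close>

lemma product_vector_push:
  assumes "product_vector I d v"
  shows "product_vector J d' (push v)"
proof -
  obtain a where v: "v = tensor_prod I d a" and "v \<noteq> 0"
    using assms by (auto simp: product_vector_def)
  have "pull (push v) = v"
    using v by (simp add: pull_push tensor_prod_in_tensor_space)
  then have "push v \<noteq> 0"
    using \<open>v \<noteq> 0\<close> pull_0 by auto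
  \<comment> \<open>The vector of merged party \<open>j\<close>: the tensor product over block
    \<open>j\<close>, transported along \<open>e j\<close> and set to zero at numbers that code no
    multi-index.\<close>
  define b where "b j m = (if m \<in> e j ` multi_indices (block j) d
      then \<Prod>i\<in>block j. a i (the_inv_into (multi_indices (block j) d) (e j) m i) else 0)" for j m
  have "push v = tensor_prod J d' b"
  proof
    fix y
    show "push v y = tensor_prod J d' b y"
    proof (cases "y \<in> embed ` multi_indices I d")
      case True
      then obtain x where x: "x \<in> multi_indices I d" and y: "y = embed x" by blast
      have "b j (y j) = (\<Prod>i\<in>block j. a i (x i))" if "j \<in> J" for j
        using that restrict_block[OF x, of j]
        by (simp add: b_def y embed_def the_inv_into_f_f inj_on_e)
      then have "(\<Prod>j\<in>J. b j (y j)) = (\<Prod>i\<in>I. a i (x i))"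
        unfolding prod.image_gen[OF finite_I, of "\<lambda>i. a i (x i)" \<pi>]
        by (simp add: J_eq block_def)
      then show ?thesis
        using x embed_in[OF x] unfolding y by (simp add: push_embed v tensor_prod_def)
    next
      case False
      \<comment> \<open>Either \<open>y\<close> is no multi-index of the merged system, or by the
        box property some coordinate \<open>y j\<close> is not a code, so that the factor
        \<open>b j (y j)\<close> vanishes.\<close>
      then have "tensor_prod J d' b y = 0"
        using in_range_embed[of y] finite_J
        by (auto simp: tensor_prod_def b_def prod_zero_iff)
      with False show ?thesis by (simp add: push_outside)
    qed
  qed
  with \<open>push v \<noteq> 0\<close> show ?thesis by (auto simp: product_vector_def)
qed

text \<open>A bipartition of the merged parties pulls back along \<open>\<pi>\<close> to one of the
  original parties. The part of \<open>embed x\<close> in \<open>A'\<close> depends only on the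
  entries of \<open>x\<close> at the preimage of \<open>A'\<close>, and likewise for
  \<open>B'\<close>, so the factorization survives.\<close>

lemma biproduct_vector_pull:
  assumes v: "biproduct_vector A' B' d' v" and AB: "A' \<union> B' = J" and "pull v \<noteq> 0"
  shows "biproduct_vector (I \<inter> \<pi> -` A') (I \<inter> \<pi> -` B') d (pull v)"
proof -
  obtain f g where fg: "v = tensor_pair A' B' d' f g"
    using v by (auto simp: biproduct_vector_def)
  \<comment> \<open>This is \<open>pull\<close> restricted to the merged parties in
    \<open>C\<close>; the value zero elsewhere puts it in the tensor space of the preimage of
    \<open>C\<close>.\<close>
  define lift where "lift C h =
    (\<lambda>z. if z \<in> multi_indices (I \<inter> \<pi> -` C) d then h (\<lambda>j\<in>C. e j (restrict z (block j))) else 0)"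
    for C and h :: tensor
  have lift_restrict: "lift C h (restrict x (I \<inter> \<pi> -` C)) = h (restrict (embed x) C)"
    if x: "x \<in> multi_indices I d" and "C \<subseteq> J" for C h x
  proof -
    have r: "restrict (restrict x (I \<inter> \<pi> -` C)) (block j) = restrict x (block j)" if "j \<in> C" for j
      using that by (auto simp: block_def fun_eq_iff)
    have "(\<lambda>j\<in>C. e j (restrict (restrict x (I \<inter> \<pi> -` C)) (block j))) = restrict (embed x) C"
      using \<open>C \<subseteq> J\<close> by (intro ext) (auto simp: embed_def r simp del: restrict_restrict)
    then show ?thesis
      using restrict_multi_indices[OF x, of "I \<inter> \<pi> -` C"] by (simp add: lift_def)
  qed
  have I: "(I \<inter> \<pi> -` A') \<union> (I \<inter> \<pi> -` B') = I"
    using AB by (auto simp: J_eq)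
  have "pull v = tensor_pair (I \<inter> \<pi> -` A') (I \<inter> \<pi> -` B') d (lift A' f) (lift B' g)"
  proof
    fix x
    show "pull v x = tensor_pair (I \<inter> \<pi> -` A') (I \<inter> \<pi> -` B') d (lift A' f) (lift B' g) x"
      using embed_in[of x] AB lift_restrict[of x A' f] lift_restrict[of x B' g]
      unfolding tensor_pair_def I by (auto simp: pull_def fg tensor_pair_def)
  qed
  moreover have "lift C h \<in> tensor_space (I \<inter> \<pi> -` C) d" for C h
    by (simp add: lift_def tensor_space_def)
  ultimately show ?thesis
    using \<open>pull v \<noteq> 0\<close> unfolding biproduct_vector_def by blast
qed

section \<open>The enlarged basis and its orthogonal complement\<close>

definition extended_basis :: "tensor set \<Rightarrow> tensor set" where
  "extended_basis S =
     push ` S \<union> basis_tensor ` (multi_indices J d' - embed ` multi_indices I d)"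

lemma orth_complement_extended_basis:
  "orth_complement J d' (extended_basis S) = push ` orth_complement I d S"
proof (intro equalityI subsetI)
  fix v assume v: "v \<in> orth_complement J d' (extended_basis S)"
  have "v y = 0" if "y \<notin> embed ` multi_indices I d" for y
  proof (cases "y \<in> multi_indices J d'")
    case True
    then have "tensor_inner J d' (basis_tensor y) v = 0"
      using v that by (auto simp: orth_complement_def extended_basis_def)
    with True show ?thesis by (simp add: tensor_inner_basis_tensor finite_J)
  qed (use v in \<open>auto simp: orth_complement_def tensor_space_def\<close>)
  then have "push (pull v) = v" by (rule push_pull)
  moreover have "pull v \<in> orth_complement I d S"
    using v by (auto simp: orth_complement_def extended_basis_def pull_in ball_Un
        simp flip: tensor_inner_push)
  ultimately show "v \<in> push ` orth_complement I d S" by (metis imageI)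
next
  fix v assume "v \<in> push ` orth_complement I d S"
  then show "v \<in> orth_complement J d' (extended_basis S)"
    by (auto simp: orth_complement_def extended_basis_def push_in tensor_inner_push pull_push
        tensor_inner_basis_tensor finite_J push_outside)
qed

text \<open>\<open>push\<close> preserves inner products, and pushed vectors vanish wherever the
  added basis vectors are supported.\<close>

lemma orthonormal_extended_basis:
  assumes on: "orthonormal I d S" and S: "S \<subseteq> tensor_space I d"
  shows "orthonormal J d' (extended_basis S)"
proof -
  let ?R = "multi_indices J d' - embed ` multi_indices I d"
  have "tensor_inner J d' (push u) (push v) = (if push u = push v then 1 else 0)"
    if "u \<in> S" "v \<in> S" for u v
  proof -
    have "push u = push v \<longleftrightarrow> u = v"
      using that S by (metis pull_push subsetD)
    then show ?thesis
      using on that S by (auto simp: orthonormal_def tensor_inner_push pull_push subset_iff)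
  qed
  \<comment> \<open>\<open>orthonormal\<close> compares the vectors themselves, so a pushed vector
    must also be shown to differ from every added basis vector; the coordinate \<open>y\<close>
    separates them.\<close>
  moreover have "tensor_inner J d' (basis_tensor y) (push v) = 0"
      "tensor_inner J d' (push v) (basis_tensor y) = 0"
      "push v \<noteq> basis_tensor y" "basis_tensor y \<noteq> push v"
    if "y \<in> ?R" for y v
  proof -
    show 1: "tensor_inner J d' (basis_tensor y) (push v) = 0"
      using that by (simp add: tensor_inner_basis_tensor finite_J push_outside)
    then show "tensor_inner J d' (push v) (basis_tensor y) = 0"
      by (simp add: tensor_inner_cnj[of J d' "push v"])
    have "push v y \<noteq> basis_tensor y y"
      using that by (simp add: push_outside basis_tensor_def)
    then show "push v \<noteq> basis_tensor y" "basis_tensor y \<noteq> push v" by auto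
  qed
  moreover have "tensor_inner J d' (basis_tensor y) (basis_tensor z) =
      (if basis_tensor y = basis_tensor z then 1 else 0)" if "y \<in> ?R" for y z
  proof -
    have "basis_tensor y = basis_tensor z \<longleftrightarrow> y = z"
      by (auto simp: basis_tensor_def fun_eq_iff)
    then show ?thesis
      using that by (simp add: tensor_inner_basis_tensor finite_J) (simp add: basis_tensor_def)
  qed
  ultimately show ?thesis
    unfolding orthonormal_def extended_basis_def by (simp add: ball_Un)
qed

text \<open>A biproduct vector in the new complement is some \<open>push w\<close> with
  \<open>w\<close> in the old one, and pulling it back would make \<open>w\<close> a biproduct
  vector.\<close>

lemma genuinely_entangled_extended_basis:
  assumes ge: "genuinely_entangled I d (orth_complement I d S)"
  shows "genuinely_entangled J d' (orth_complement J d' (extended_basis S))"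
proof -
  let ?W = "orth_complement I d S" and ?W' = "orth_complement J d' (extended_basis S)"
  have pull: "pull v \<in> ?W" "push (pull v) = v" if "v \<in> ?W'" for v
    using that unfolding orth_complement_extended_basis
    by (auto simp: pull_push orth_complement_def[of I])
  obtain w where w: "w \<in> ?W" "w \<noteq> 0"
    using genuinely_entangled_nonzero[OF ge] by blast
  then have "pull (push w) = w"
    by (simp add: pull_push orth_complement_def)
  with w(2) have "push w \<noteq> 0"
    using pull_0 by auto
  moreover have "push w \<in> ?W'"
    using w(1) by (simp add: orth_complement_extended_basis)
  ultimately have "?W' \<noteq> {0}" by blast
  moreover have "\<not> biproduct_vector A' B' d' v"
    if AB: "A' \<noteq> {}" "B' \<noteq> {}" "A' \<inter> B' = {}" "A' \<union> B' = J" and v: "v \<in> ?W'" for A' B' v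
  proof
    assume bi: "biproduct_vector A' B' d' v"
    then have "pull v \<noteq> 0"
      using pull(2)[OF v] push_0 by (auto simp: biproduct_vector_def)
    with bi AB have bi': "biproduct_vector (I \<inter> \<pi> -` A') (I \<inter> \<pi> -` B') d (pull v)"
      by (intro biproduct_vector_pull)
    have sub: "A' \<subseteq> \<pi> ` I" "B' \<subseteq> \<pi> ` I" "\<pi> ` I \<subseteq> A' \<union> B'"
      using AB(4) J_eq by auto
    \<comment> \<open>Every merged label comes from some party, so nonempty groups have nonempty
      preimages.\<close>
    have ne: "I \<inter> \<pi> -` A' \<noteq> {}" "I \<inter> \<pi> -` B' \<noteq> {}"
      using sub(1) AB(1) sub(2) AB(2) by (fast, fast)
    have disj: "(I \<inter> \<pi> -` A') \<inter> (I \<inter> \<pi> -` B') = {}"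
      using AB(3) by auto
    have un: "(I \<inter> \<pi> -` A') \<union> (I \<inter> \<pi> -` B') = I"
      using sub(3) by auto
    show False
      using genuinely_entangledD[OF ge pull(1)[OF v] ne disj un] bi' by (rule notE)
  qed
  moreover have "?W' \<subseteq> tensor_space J d'"
    by (auto simp: orth_complement_def)
  ultimately show ?thesis
    by (simp add: genuinely_entangled_def subspace_orth_complement)
qed

lemma geupb_extended_basis:
  assumes S: "geupb I d S" and AB: "A \<noteq> {}" "B \<noteq> {}" "A \<inter> B = {}" "A \<union> B = J"
  shows "geupb J d' (extended_basis S)"
proof -
  have prod: "\<And>v. v \<in> S \<Longrightarrow> product_vector I d v" and "orthonormal I d S"
    and ge: "genuinely_entangled I d (orth_complement I d S)"
    using S by (auto simp: geupb_def upb_def)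
  moreover have "S \<subseteq> tensor_space I d"
    using prod tensor_prod_in_tensor_space by (auto simp: product_vector_def)
  moreover have "\<forall>v\<in>extended_basis S. product_vector J d' v"
    using prod
    by (auto simp: extended_basis_def product_vector_push product_vector_basis_tensor finite_J)
  ultimately show ?thesis
    unfolding geupb_iff[OF finite_J AB]
    by (simp add: orthonormal_extended_basis genuinely_entangled_extended_basis)
qed

end

section \<open>Choice of the codes, of three groups and of a common dimension\<close>

lemma geupb_coarsen:
  assumes S: "geupb I d S" and I: "finite I" "J = \<pi> ` I"
    and dim: "\<And>j. j \<in> J \<Longrightarrow> card (multi_indices {i\<in>I. \<pi> i = j} d) \<le> d' j"
    and AB: "A \<noteq> {}" "B \<noteq> {}" "A \<inter> B = {}" "A \<union> B = J"
  shows "\<exists>S'. geupb J d' S'"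
proof -
  \<comment> \<open>The number of multi-indices of a block is its dimension; once
    \<open>d' j\<close> is at least that large, an injective code exists.\<close>
  have "\<exists>f. f ` multi_indices {i\<in>I. \<pi> i = j} d \<subseteq> {..<d' j} \<and>
      inj_on f (multi_indices {i\<in>I. \<pi> i = j} d)" if "j \<in> J" for j
    using dim[OF that] I(1) by (intro card_le_inj) (auto simp: finite_multi_indices)
  then obtain e where e: "\<And>j. j \<in> J \<Longrightarrow> e j ` multi_indices {i\<in>I. \<pi> i = j} d \<subseteq> {..<d' j} \<and>
      inj_on (e j) (multi_indices {i\<in>I. \<pi> i = j} d)"
    by metis
  interpret coarsening I d J d' \<pi> e
  proof
    show "finite I" "J = \<pi> ` I" by fact+
    show "inj_on (e j) (multi_indices {i\<in>I. \<pi> i = j} d)" if "j \<in> J" for j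
      using e[OF that] by blast
    show "e j z < d' j" if "j \<in> J" "z \<in> multi_indices {i\<in>I. \<pi> i = j} d" for j z
      using e[OF that(1)] that(2) by blast
  qed
  show ?thesis
    using geupb_extended_basis[OF S AB] by blast
qed

theorem theorem8:
  "(\<exists>(k::nat) d S. k \<ge> 3 \<and> geupb {..<k} d S) \<longleftrightarrow>
   (\<exists>(n::nat) S. geupb {..<3} (\<lambda>_. n) S)"
proof
  assume "\<exists>(k::nat) d S. k \<ge> 3 \<and> geupb {..<k} d S"
  then obtain k d S where k: "3 \<le> k" and S: "geupb {..<k} d S" by blast
  \<comment> \<open>Parties 0 and 1 stay single and all others merge into party 2. Since
    \<open>k\<close> is at least 3, all three labels occur.\<close>
  define \<pi> where "\<pi> i = min i 2" for i :: nat
  define c where "c j = card (multi_indices {i\<in>{..<k}. \<pi> i = j} d)" for j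
  have J: "{..<3} = \<pi> ` {..<k}"
  proof
    show "{..<3} \<subseteq> \<pi> ` {..<k}"
    proof
      fix j :: nat assume "j \<in> {..<3}"
      then show "j \<in> \<pi> ` {..<k}"
        using k by (intro image_eqI[of _ _ j]) (auto simp: \<pi>_def)
    qed
  qed (auto simp: \<pi>_def)
  \<comment> \<open>The sum of the three block dimensions bounds each of them and so serves as the
    common dimension \<open>n\<close>.\<close>
  have "c j \<le> (\<Sum>j<3. c j)" if "j \<in> {..<3}" for j
    using that by (intro member_le_sum) auto
  then have "\<exists>S'. geupb {..<3} (\<lambda>_. \<Sum>j<3. c j) S'"
    by (intro geupb_coarsen[OF S _ J, where A = "{0}" and B = "{1,2}"]) (auto simp: c_def)
  then show "\<exists>(n::nat) S. geupb {..<3} (\<lambda>_. n) S" by blast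
next
  assume "\<exists>(n::nat) S. geupb {..<3} (\<lambda>_. n) S"
  then show "\<exists>(k::nat) d S. k \<ge> 3 \<and> geupb {..<k} d S" by blast
qed

end
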